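(* Let $A \colon G \times Y \to Y$ be a homotopy-associative action of a group-like space $G$ on a based space $Y$. For each $x \in Y$ let $Y_x \subseteq Y$ denote the path component of $Y$ containing $x$, and write $g\cdot x = A(g,x)$ for $g\in G$, $x \in Y$. Then for each $x \in Y$ and each $g \in G$, the path components $Y_x$ and $Y_{g\cdot x}$ have the same (free) homotopy type. If $Y_x$ and $Y_{g\cdot x}$ both have non-degenerate basepoints, then $Y_x$ and $Y_{g\cdot x}$ have the same based homotopy type with respect to these basepoints.
   Context: $\sim$ denotes free homotopy and $\sim_*$ denotes based homotopy. A basepoint is non-degenerate if its inclusion is a cofibration. Here $Y$ need not be path connected. An H-space is a based space $G$ with a based map $m \colon G\times G\to G$ such that $m\circ J\sim_*\nabla\colon G\vee G\to G$, where $J\colon G\vee G\to G\times G$ is the inclusion and $\nabla$ is the folding map. It is homotopy-associative if $m\circ(m\times 1)\sim_* m\circ(1\times m)$. A group-like space is a homotopy-associative H-space $G$ together with a based map $\iota\colon G\to G$ such that $m\circ(\iota\times 1)\circ\Delta\sim_* 0$ and $m\circ(1\times\iota)\circ\Delta\sim_* 0$, where $\Delta$ is the diagonal map and $0$ is the constant map at the basepoint. A homotopy-associative action of a homotopy-associative H-space $G$ on a based space $Y$ is a based map $A\colon G\times Y\to Y$ such that $A\circ i_2\sim_* 1\colon Y\to Y$ and $A\circ(1\times A)\sim_* A\circ(m\times 1)\colon G\times G\times Y\to Y$, where $i_2\colon Y\to G\times Y$ is the inclusion $y \mapsto (e,y)$, with $e$ the basepoint of $G$. *)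

theory Defs
  imports "HOL-Analysis.Analysis"
begin

section \<open>Based spaces, based maps and based homotopy\<close>

definition based_space :: "'a topology \<Rightarrow> 'a \<Rightarrow> bool" where
  "based_space X x0 \<longleftrightarrow> x0 \<in> topspace X"

definition based_map :: "'a topology \<Rightarrow> 'a \<Rightarrow> 'b topology \<Rightarrow> 'b \<Rightarrow> ('a \<Rightarrow> 'b) \<Rightarrow> bool" where
  "based_map X x0 Y y0 f \<longleftrightarrow> continuous_map X Y f \<and> f x0 = y0"

definition based_homotopic ::
    "'a topology \<Rightarrow> 'a \<Rightarrow> 'b topology \<Rightarrow> 'b \<Rightarrow> ('a \<Rightarrow> 'b) \<Rightarrow> ('a \<Rightarrow> 'b) \<Rightarrow> bool" where
  "based_homotopic X x0 Y y0 f g \<longleftrightarrow> homotopic_with (\<lambda>h. h x0 = y0) X Y f g"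

definition based_homotopy_equivalent ::
    "'a topology \<Rightarrow> 'a \<Rightarrow> 'b topology \<Rightarrow> 'b \<Rightarrow> bool" where
  "based_homotopy_equivalent X x0 Y y0 \<longleftrightarrow>
     (\<exists>f g. based_map X x0 Y y0 f \<and> based_map Y y0 X x0 g \<and>
            based_homotopic X x0 X x0 (g \<circ> f) id \<and>
            based_homotopic Y y0 Y y0 (f \<circ> g) id)"


section \<open>Cofibrations and non-degenerate basepoints\<close>

definition homotopy_extension_property :: "'a topology \<Rightarrow> 'a set \<Rightarrow> 'z topology \<Rightarrow> bool" where
  "homotopy_extension_property X S Z \<longleftrightarrow>
     (\<forall>f h. continuous_map X Z f \<and>
            continuous_map (prod_topology (top_of_set {0..1::real}) (subtopology X S)) Z h \<and>
            (\<forall>a\<in>S. h (0, a) = f a)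
        \<longrightarrow> (\<exists>H. continuous_map (prod_topology (top_of_set {0..1::real}) X) Z H \<and>
                 (\<forall>x\<in>topspace X. H (0, x) = f x) \<and>
                 (\<forall>t\<in>{0..1}. \<forall>a\<in>S. H (t, a) = h (t, a))))"

text \<open>
  The inclusion of \<open>S\<close> into \<open>X\<close> is a cofibration if it has the homotopy extension property with
  respect to every space \<open>Z\<close>. A definition cannot quantify over the type carrying \<open>Z\<close>, so \<open>Z\<close>
  ranges over all topologies on one type that is large enough to carry the mapping cylinder of
  the inclusion. The lemma \<open>cofibration_imp_homotopy_extension_property\<close> below shows that the
  property then holds for spaces \<open>Z\<close> on arbitrary types.
\<close>

definition cofibration :: "'a topology \<Rightarrow> 'a set \<Rightarrow> bool" where
  "cofibration X S \<longleftrightarrow>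
     S \<subseteq> topspace X \<and> (\<forall>Z :: (real \<times> 'a) topology. homotopy_extension_property X S Z)"

lemma cofibration_imp_homotopy_extension_property:
  fixes X :: "'a topology" and Z :: "'z topology"
  assumes "cofibration X S"
  shows "homotopy_extension_property X S Z"
  unfolding homotopy_extension_property_def
proof (intro allI impI, elim conjE)
  fix f h
  let ?C = "prod_topology (top_of_set {0..1::real}) (subtopology X S)"
  assume f: "continuous_map X Z f" and h: "continuous_map ?C Z h"
    and hf: "\<forall>a\<in>S. h (0, a) = f a"
  have S: "S \<subseteq> topspace X" using assms by (simp add: cofibration_def)
  have topC: "topspace ?C = {0..1} \<times> S" using S by auto
  define N where "N = ({0} \<times> topspace X) \<union> ({0..1::real} \<times> S)"
  define L where "L = (\<lambda>U. U \<subseteq> N \<and> openin X {x \<in> topspace X. (0, x) \<in> U} \<and>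
                          openin ?C {p \<in> topspace ?C. p \<in> U})"
  have "istopology L"
    unfolding istopology_def
  proof (intro conjI allI impI)
    fix U V assume UV: "L U" "L V"
    have 1: "{x \<in> topspace X. (0, x) \<in> U \<inter> V} =
        {x \<in> topspace X. (0, x) \<in> U} \<inter> {x \<in> topspace X. (0, x) \<in> V}" by auto
    have 2: "{p \<in> topspace ?C. p \<in> U \<inter> V} =
        {p \<in> topspace ?C. p \<in> U} \<inter> {p \<in> topspace ?C. p \<in> V}" by auto
    show "L (U \<inter> V)"
      using UV unfolding L_def 1 2 by (blast intro: openin_Int)
  next
    fix K assume K: "\<forall>U\<in>K. L U"
    have 1: "{x \<in> topspace X. (0, x) \<in> \<Union>K} = \<Union>((\<lambda>U. {x \<in> topspace X. (0, x) \<in> U}) ` K)" by auto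
    have 2: "{p \<in> topspace ?C. p \<in> \<Union>K} = \<Union>((\<lambda>U. {p \<in> topspace ?C. p \<in> U}) ` K)" by auto
    have 3: "openin X (\<Union>((\<lambda>U. {x \<in> topspace X. (0, x) \<in> U}) ` K))"
      using K by (intro openin_Union) (auto simp: L_def)
    have 4: "openin ?C (\<Union>((\<lambda>U. {p \<in> topspace ?C. p \<in> U}) ` K))"
      using K by (intro openin_Union) (auto simp: L_def)
    have 5: "\<Union>K \<subseteq> N" using K by (auto simp: L_def)
    show "L (\<Union>K)" unfolding L_def 1 2 by (intro conjI 3 4 5)
  qed
  define M where "M = topology L"
  have openM: "openin M = L"
    using \<open>istopology L\<close> by (simp add: M_def)
  have "L N"
  proof -
    have 1: "{x \<in> topspace X. (0, x) \<in> N} = topspace X" by (auto simp: N_def)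
    have 2: "{p \<in> topspace ?C. p \<in> N} = topspace ?C" unfolding topC by (auto simp: N_def)
    show ?thesis unfolding L_def 1 2 by (intro conjI openin_topspace subset_refl)
  qed
  then have topM: "topspace M = N"
    unfolding topspace_def openM by (auto simp: L_def)
  have j: "continuous_map X M (\<lambda>x. (0, x))"
    unfolding continuous_map_def topM openM by (auto simp: N_def L_def)
  have k: "continuous_map ?C M id"
    unfolding continuous_map_def topM openM
  proof (intro conjI allI impI)
    show "id \<in> topspace ?C \<rightarrow> N" unfolding topC by (auto simp: N_def)
    show "openin ?C {p \<in> topspace ?C. id p \<in> U}" if "L U" for U
      using that unfolding L_def id_apply by (elim conjE)
  qed
  have "homotopy_extension_property X S M"
    using assms by (simp add: cofibration_def)
  then have "\<exists>H. continuous_map (prod_topology (top_of_set {0..1::real}) X) M H \<and>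
                 (\<forall>x\<in>topspace X. H (0, x) = (0, x)) \<and>
                 (\<forall>t\<in>{0..1}. \<forall>a\<in>S. H (t, a) = id (t, a))"
    unfolding homotopy_extension_property_def
    by (elim allE[of _ "\<lambda>x. (0, x)"] allE[of _ id] impE) (intro conjI ballI j k id_apply)
  then obtain H where H: "continuous_map (prod_topology (top_of_set {0..1::real}) X) M H"
      "\<And>x. x \<in> topspace X \<Longrightarrow> H (0, x) = (0, x)"
      "\<And>t a. t \<in> {0..1} \<Longrightarrow> a \<in> S \<Longrightarrow> H (t, a) = (t, a)"
    unfolding id_apply by blast
  define \<phi> where "\<phi> = (\<lambda>p. if snd p \<in> S then h p else f (snd p))"
  have \<phi>0: "\<phi> (0, x) = f x" for x using hf by (simp add: \<phi>_def)
  have \<phi>C: "\<phi> p = h p" if "p \<in> topspace ?C" for p using that unfolding topC by (auto simp: \<phi>_def)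
  have "continuous_map M Z \<phi>"
    unfolding continuous_map_def
  proof (intro conjI allI impI)
    show "\<phi> \<in> topspace M \<rightarrow> topspace Z"
    proof
      fix p assume "p \<in> topspace M"
      then consider x where "p = (0, x)" "x \<in> topspace X" | "p \<in> topspace ?C"
        unfolding topM N_def topC by auto
      then show "\<phi> p \<in> topspace Z"
      proof cases
        case 1 then show ?thesis using f by (auto simp: \<phi>0 continuous_map_def)
      next
        case 2 then show ?thesis using continuous_map_funspace[OF h] \<phi>C by fastforce
      qed
    qed
  next
    fix U assume U: "openin Z U"
    have "{x \<in> topspace X. (0, x) \<in> {p \<in> topspace M. \<phi> p \<in> U}} = {x \<in> topspace X. f x \<in> U}"
      by (auto simp: \<phi>0 topM N_def)
    moreover have "topspace ?C \<subseteq> N" unfolding topC N_def by auto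
    then have "{p \<in> topspace ?C. p \<in> {p \<in> topspace M. \<phi> p \<in> U}} = {p \<in> topspace ?C. h p \<in> U}"
      using \<phi>C unfolding topM by auto
    ultimately show "openin M {p \<in> topspace M. \<phi> p \<in> U}"
      using openin_continuous_map_preimage[OF f U] openin_continuous_map_preimage[OF h U]
      unfolding openM L_def by (simp add: topM)
  qed
  then have "continuous_map (prod_topology (top_of_set {0..1::real}) X) Z (\<phi> \<circ> H)"
    using H(1) by (rule continuous_map_compose[rotated])
  moreover have "\<forall>x\<in>topspace X. (\<phi> \<circ> H) (0, x) = f x"
    by (simp add: H(2) \<phi>0)
  moreover have "\<forall>t\<in>{0..1}. \<forall>a\<in>S. (\<phi> \<circ> H) (t, a) = h (t, a)"
    by (simp add: H(3) \<phi>_def)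
  ultimately show "\<exists>H. continuous_map (prod_topology (top_of_set {0..1::real}) X) Z H \<and>
                 (\<forall>x\<in>topspace X. H (0, x) = f x) \<and>
                 (\<forall>t\<in>{0..1}. \<forall>a\<in>S. H (t, a) = h (t, a))"
    by (intro exI conjI)
qed

definition nondegenerate_basepoint :: "'a topology \<Rightarrow> 'a \<Rightarrow> bool" where
  "nondegenerate_basepoint X x0 \<longleftrightarrow> x0 \<in> topspace X \<and> cofibration X {x0}"


section \<open>Group-like spaces and homotopy-associative actions\<close>

text \<open>
  The wedge of \<open>X\<close> with itself, realised as the union of the two axes in the product, so that the
  inclusion into the product is the identity function. The lemma \<open>quotient_map_wedge\<close>
  identifies it with the one-point union, i.e. the quotient of the disjoint sum of two copies of
  \<open>X\<close> gluing the basepoints.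
\<close>

definition wedge :: "'a topology \<Rightarrow> 'a \<Rightarrow> ('a \<times> 'a) topology" where
  "wedge X x0 = subtopology (prod_topology X X) {(x, y). x = x0 \<or> y = x0}"

definition folding_map :: "'a \<Rightarrow> 'a \<times> 'a \<Rightarrow> 'a" where
  "folding_map x0 = (\<lambda>(x, y). if y = x0 then x else y)"

lemma quotient_map_wedge:
  assumes "x0 \<in> topspace X"
  shows "quotient_map (sum_topology (\<lambda>_. X) (UNIV :: bool set)) (wedge X x0)
           (\<lambda>(b, x). if b then (x0, x) else (x, x0))"
proof -
  let ?q = "\<lambda>(b, x). if b then (x0, x) else (x, x0)"
  let ?S = "sum_topology (\<lambda>_. X) (UNIV :: bool set)"
  have top: "topspace (wedge X x0) = {(x, y). x \<in> topspace X \<and> y \<in> topspace X \<and> (x = x0 \<or> y = x0)}"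
    by (auto simp: wedge_def)
  have c1: "continuous_map X (wedge X x0) (\<lambda>x. (x0, x))"
    and c2: "continuous_map X (wedge X x0) (\<lambda>x. (x, x0))"
    using assms by (auto simp: wedge_def continuous_map_in_subtopology continuous_map_pairwise o_def)
  have "openin ?S {p \<in> topspace ?S. ?q p \<in> U} \<longleftrightarrow> openin (wedge X x0) U"
    if U: "U \<subseteq> topspace (wedge X x0)" for U
  proof -
    let ?A = "{x \<in> topspace X. (x, x0) \<in> U}" and ?B = "{x \<in> topspace X. (x0, x) \<in> U}"
    have "{x. (True, x) \<in> {p \<in> topspace ?S. ?q p \<in> U}} = ?B"
      "{x. (False, x) \<in> {p \<in> topspace ?S. ?q p \<in> U}} = ?A" by auto
    then have "openin ?S {p \<in> topspace ?S. ?q p \<in> U} \<longleftrightarrow> openin X ?A \<and> openin X ?B"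
      unfolding openin_sum_topology by (auto simp: all_bool_eq)
    also have "\<dots> \<longleftrightarrow> openin (wedge X x0) U"
    proof
      assume AB: "openin X ?A \<and> openin X ?B"
      show "openin (wedge X x0) U"
      proof (cases "(x0, x0) \<in> U")
        case True
        have "U = (?A \<times> ?B) \<inter> {(x, y). x = x0 \<or> y = x0}"
          using U True assms unfolding top by fast
        moreover have "openin (prod_topology X X) (?A \<times> ?B)"
          using AB by (simp add: openin_prod_Times_iff)
        ultimately show ?thesis unfolding wedge_def openin_subtopology by blast
      next
        case False
        let ?W = "(?A \<times> topspace X) \<union> (topspace X \<times> ?B)"
        have "(x, y) \<in> U \<longleftrightarrow> (x, y) \<in> ?W \<inter> {(x, y). x = x0 \<or> y = x0}" for x y
        proof -
          have "(x, y) \<in> U \<Longrightarrow> x \<in> topspace X \<and> y \<in> topspace X \<and> (x = x0 \<or> y = x0)"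
            using U top by auto
          then show ?thesis using False assms by (cases "x = x0"; cases "y = x0") auto
        qed
        then have "U = ?W \<inter> {(x, y). x = x0 \<or> y = x0}" by (intro set_eqI) (rule prod.induct)
        moreover have "openin (prod_topology X X) ?W"
          using AB by (intro openin_Un) (simp_all add: openin_prod_Times_iff)
        ultimately show ?thesis unfolding wedge_def openin_subtopology by blast
      qed
    next
      assume "openin (wedge X x0) U"
      then show "openin X ?A \<and> openin X ?B"
        using openin_continuous_map_preimage[OF c1] openin_continuous_map_preimage[OF c2] by blast
    qed
    finally show ?thesis .
  qed
  moreover have "?q ` topspace ?S = topspace (wedge X x0)"
  proof
    show "?q ` topspace ?S \<subseteq> topspace (wedge X x0)"
      using assms unfolding top by (auto split: if_splits)
    show "topspace (wedge X x0) \<subseteq> ?q ` topspace ?S"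
    proof
      fix p assume "p \<in> topspace (wedge X x0)"
      then consider x where "p = ?q (True, x)" "x \<in> topspace X"
        | x where "p = ?q (False, x)" "x \<in> topspace X"
        unfolding top by auto
      then show "p \<in> ?q ` topspace ?S" by cases (auto intro!: image_eqI)
    qed
  qed
  ultimately show ?thesis unfolding quotient_map_def by blast
qed

definition H_space :: "'g topology \<Rightarrow> 'g \<Rightarrow> ('g \<times> 'g \<Rightarrow> 'g) \<Rightarrow> bool" where
  "H_space G e m \<longleftrightarrow>
     based_space G e \<and>
     based_map (prod_topology G G) (e, e) G e m \<and>
     based_homotopic (wedge G e) (e, e) G e m (folding_map e)"

definition homotopy_associative_H_space :: "'g topology \<Rightarrow> 'g \<Rightarrow> ('g \<times> 'g \<Rightarrow> 'g) \<Rightarrow> bool" where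
  "homotopy_associative_H_space G e m \<longleftrightarrow>
     H_space G e m \<and>
     based_homotopic (prod_topology G (prod_topology G G)) (e, e, e) G e
       (\<lambda>(a, b, c). m (m (a, b), c)) (\<lambda>(a, b, c). m (a, m (b, c)))"

definition group_like_space ::
    "'g topology \<Rightarrow> 'g \<Rightarrow> ('g \<times> 'g \<Rightarrow> 'g) \<Rightarrow> ('g \<Rightarrow> 'g) \<Rightarrow> bool" where
  "group_like_space G e m \<iota> \<longleftrightarrow>
     homotopy_associative_H_space G e m \<and>
     based_map G e G e \<iota> \<and>
     based_homotopic G e G e (\<lambda>a. m (\<iota> a, a)) (\<lambda>_. e) \<and>
     based_homotopic G e G e (\<lambda>a. m (a, \<iota> a)) (\<lambda>_. e)"

definition homotopy_associative_action ::
    "'g topology \<Rightarrow> 'g \<Rightarrow> ('g \<times> 'g \<Rightarrow> 'g) \<Rightarrow> 'y topology \<Rightarrow> 'y \<Rightarrow> ('g \<times> 'y \<Rightarrow> 'y) \<Rightarrow> bool" where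
  "homotopy_associative_action G e m Y y0 A \<longleftrightarrow>
     homotopy_associative_H_space G e m \<and>
     based_space Y y0 \<and>
     based_map (prod_topology G Y) (e, y0) Y y0 A \<and>
     based_homotopic Y y0 Y y0 (\<lambda>y. A (e, y)) id \<and>
     based_homotopic (prod_topology G (prod_topology G Y)) (e, e, y0) Y y0
       (\<lambda>(a, b, y). A (a, A (b, y))) (\<lambda>(a, b, y). A (m (a, b), y))"

definition path_component_space :: "'a topology \<Rightarrow> 'a \<Rightarrow> 'a topology" where
  "path_component_space X x = subtopology X (path_component_of_set X x)"

end

theory Submission
  imports Defs
begin

text \<open>
  Acting by \<open>g\<close> and by \<open>\<iota> g\<close> gives self-maps of \<open>Y\<close> that are mutually inverse up to free homotopy,
  because a homotopy from \<open>m (\<iota> a, a)\<close> to the constant map contains a path from \<open>m (\<iota> g, g)\<close> to \<open>e\<close>.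
  Homotopies to the identity restrict to path components, which yields the free equivalence.

  A free equivalence of path connected well-pointed spaces can be deformed until it is based. That
  it then is a based equivalence rests on one fact: two homotopies out of a well-pointed space with
  the same start and the same track of the basepoint have ends that are homotopic relative to the
  basepoint. This is the homotopy extension property for maps into a path space, which is why the
  compact-open topology appears.
\<close>

section \<open>The compact-open topology\<close>

text \<open>The points are total functions. Those that agree on \<open>topspace T\<close> are
  topologically indistinguishable, but they remain distinct points.\<close>

definition compact_open_topology :: "'a topology \<Rightarrow> 'b topology \<Rightarrow> ('a \<Rightarrow> 'b) topology" where
  "compact_open_topology T Z = topology_generated_by
     {{c. continuous_map T Z c \<and> c \<in> K \<rightarrow> U} | K U. compactin T K \<and> openin Z U}"

lemma openin_compact_open_subbasis:
  assumes "compactin T K" "openin Z U"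
  shows "openin (compact_open_topology T Z) {c. continuous_map T Z c \<and> c \<in> K \<rightarrow> U}"
  using assms unfolding compact_open_topology_def by (intro topology_generated_by_Basis) blast

lemma topspace_compact_open_topology [simp]:
  "topspace (compact_open_topology T Z) = {c. continuous_map T Z c}"
proof
  show "topspace (compact_open_topology T Z) \<subseteq> {c. continuous_map T Z c}"
    by (auto simp: compact_open_topology_def)
  \<comment> \<open>The empty compact set imposes no condition, so the set of all continuous maps is
    itself subbasic.\<close>
  have "{c. continuous_map T Z c} = {c. continuous_map T Z c \<and> c \<in> {} \<rightarrow> topspace Z}" by auto
  then show "{c. continuous_map T Z c} \<subseteq> topspace (compact_open_topology T Z)"
    using openin_subset[OF openin_compact_open_subbasis[OF compactin_empty openin_topspace, of T Z]] by simp
qed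

text \<open>For compact \<open>K\<close> and open \<open>U\<close>, the points \<open>x\<close> for
  which \<open>f x\<close> does not send \<open>K\<close> into \<open>U\<close> form the projection
  of a closed subset of \<open>K \<times> X\<close>, and projection along a compact factor is a
  closed map.\<close>

lemma continuous_map_curry:
  assumes f: "continuous_map (prod_topology T X) Z (\<lambda>(t, x). f x t)"
  shows "continuous_map X (compact_open_topology T Z) f"
  unfolding compact_open_topology_def
proof (rule continuous_on_generated_topo)
  have cont: "continuous_map T Z (f x)" if "x \<in> topspace X" for x
  proof -
    have "continuous_map T (prod_topology T X) (\<lambda>t. (t, x))"
      using that by (simp add: continuous_map_pairwise o_def)
    from continuous_map_compose[OF this f] show ?thesis by (simp add: o_def)
  qed
  show "f ` topspace X \<subseteq> \<Union> {{c. continuous_map T Z c \<and> c \<in> K \<rightarrow> U} |K U. compactin T K \<and> openin Z U}"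
  proof clarify
    fix x assume "x \<in> topspace X"
    then have "f x \<in> {c. continuous_map T Z c \<and> c \<in> {} \<rightarrow> topspace Z}" using cont by simp
    moreover have "compactin T {}" "openin Z (topspace Z)" by simp_all
    ultimately show "f x \<in> \<Union> {{c. continuous_map T Z c \<and> c \<in> K \<rightarrow> U} |K U. compactin T K \<and> openin Z U}"
      by blast
  qed
  fix S assume "S \<in> {{c. continuous_map T Z c \<and> c \<in> K \<rightarrow> U} |K U. compactin T K \<and> openin Z U}"
  then obtain K U where S: "S = {c. continuous_map T Z c \<and> c \<in> K \<rightarrow> U}"
    and K: "compactin T K" and U: "openin Z U" by blast
  have KT: "K \<subseteq> topspace T" using K compactin_subset_topspace by blast
  let ?KX = "prod_topology (subtopology T K) X"
  have "continuous_map ?KX Z (\<lambda>(t, x). f x t)"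
    using continuous_map_from_subtopology[OF f, of "K \<times> topspace X"]
    by (simp add: prod_topology_subtopology subtopology_subtopology Int_absorb1)
  then have "closedin ?KX {p \<in> topspace ?KX. (\<lambda>(t, x). f x t) p \<in> topspace Z - U}"
    by (rule closedin_continuous_map_preimage) (simp add: U closedin_diff)
  moreover have "closed_map ?KX X snd"
    by (rule Abstract_Topological_Spaces.closed_map_snd) (simp add: K compact_space_subtopology)
  ultimately have "closedin X (snd ` {p \<in> topspace ?KX. (\<lambda>(t, x). f x t) p \<in> topspace Z - U})"
    by (simp add: closed_map_def)
  then have "openin X (topspace X - snd ` {p \<in> topspace ?KX. (\<lambda>(t, x). f x t) p \<in> topspace Z - U})"
    by (rule openin_diff[OF openin_topspace])
  moreover have "topspace X - snd ` {p \<in> topspace ?KX. (\<lambda>(t, x). f x t) p \<in> topspace Z - U}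
      = f -` S \<inter> topspace X"
  proof (intro set_eqI)
    fix x
    have "f x t \<in> topspace Z" if "x \<in> topspace X" "t \<in> K" for t
      using continuous_map_funspace[OF cont[OF that(1)]] that KT by blast
    moreover have "x \<in> snd ` {p \<in> topspace ?KX. (\<lambda>(t, x). f x t) p \<in> topspace Z - U} \<longleftrightarrow>
        x \<in> topspace X \<and> (\<exists>t\<in>K. f x t \<in> topspace Z - U)"
      using KT by (force simp: image_iff)
    ultimately show "x \<in> topspace X - snd ` {p \<in> topspace ?KX. (\<lambda>(t, x). f x t) p \<in> topspace Z - U}
        \<longleftrightarrow> x \<in> f -` S \<inter> topspace X"
      using cont by (auto simp: S)
  qed
  ultimately show "openin X (f -` S \<inter> topspace X)" by simp
qed

text \<open>If \<open>c t\<close> lies in an open \<open>U\<close>, then \<open>c\<close> maps some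
  compact neighbourhood \<open>K\<close> of \<open>t\<close> into \<open>U\<close>. A nearby point
  of \<open>K\<close> and a map sending \<open>K\<close> into \<open>U\<close> then evaluate into
  \<open>U\<close>.\<close>

lemma continuous_map_eval:
  assumes T: "neighbourhood_base_of (compactin T) T"
  shows "continuous_map (prod_topology T (compact_open_topology T Z)) Z (\<lambda>(t, c). c t)"
  unfolding continuous_map_def
proof (intro conjI allI impI)
  let ?P = "prod_topology T (compact_open_topology T Z)"
  show "(\<lambda>(t, c). c t) \<in> topspace ?P \<rightarrow> topspace Z"
    by (auto dest: continuous_map_funspace)
  fix U assume U: "openin Z U"
  show "openin ?P {p \<in> topspace ?P. (\<lambda>(t, c). c t) p \<in> U}"
  proof (subst openin_subopen, clarify)
    fix t c assume tc: "(t, c) \<in> topspace ?P" and ctU: "c t \<in> U"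
    then have t: "t \<in> topspace T" and c: "continuous_map T Z c" by auto
    have "openin T {s \<in> topspace T. c s \<in> U}" using c U by (rule openin_continuous_map_preimage)
    then obtain V K where V: "openin T V" "t \<in> V" and K: "compactin T K" "V \<subseteq> K" "K \<subseteq> {s \<in> topspace T. c s \<in> U}"
      using T t ctU unfolding neighbourhood_base_of by (metis (mono_tags, lifting) mem_Collect_eq)
    let ?W = "V \<times> {c. continuous_map T Z c \<and> c \<in> K \<rightarrow> U}"
    have "openin ?P ?W"
      using V openin_compact_open_subbasis[OF K(1) U] by (simp add: openin_prod_Times_iff)
    moreover have "(t, c) \<in> ?W" using V K c by auto
    moreover have "?W \<subseteq> {p \<in> topspace ?P. (\<lambda>(t, c). c t) p \<in> U}"
      using K V openin_subset[OF V(1)] by auto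
    ultimately show "\<exists>W. openin ?P W \<and> (t, c) \<in> W \<and> W \<subseteq> {p \<in> topspace ?P. (\<lambda>(t, c). c t) p \<in> U}"
      by blast
  qed
qed

lemma continuous_map_uncurry:
  assumes "neighbourhood_base_of (compactin T) T" "continuous_map X (compact_open_topology T Z) f"
  shows "continuous_map (prod_topology T X) Z (\<lambda>(t, x). f x t)"
proof -
  have "continuous_map (prod_topology T X) (prod_topology T (compact_open_topology T Z)) (\<lambda>(t, x). (t, f x))"
    using continuous_map_compose[OF continuous_map_snd assms(2)]
    by (auto simp: case_prod_beta' continuous_map_pairwise o_def continuous_map_fst)
  from continuous_map_compose[OF this continuous_map_eval[OF assms(1)]] show ?thesis
    by (simp add: o_def case_prod_beta')
qed

section \<open>Homotopy equivalences of well-pointed spaces\<close>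

text \<open>The range of \<open>r\<close> is kept apart from its continuity, so that the rules for
  real-valued maps apply to \<open>r\<close> directly.\<close>

lemma continuous_map_reparam:
  assumes "continuous_map (prod_topology (top_of_set S) X) Z H"
    and "continuous_map W X q" "continuous_map W euclideanreal r" "r \<in> topspace W \<rightarrow> S"
  shows "continuous_map W Z (\<lambda>w. H (r w, q w))"
proof -
  have "continuous_map W (prod_topology (top_of_set S) X) (\<lambda>w. (r w, q w))"
    using assms(2-) by (auto simp: continuous_map_pairwise o_def continuous_map_in_subtopology)
  from continuous_map_compose[OF this assms(1)] show ?thesis by (simp add: o_def)
qed

lemma cofibration_singleton_extend:
  assumes "cofibration X {a}" "continuous_map X Z f"
    and "continuous_map (prod_topology (top_of_set {0..1::real}) (subtopology X {a})) Z h"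
    and "h (0, a) = f a"
  obtains H where "continuous_map (prod_topology (top_of_set {0..1::real}) X) Z H"
    "\<And>x. x \<in> topspace X \<Longrightarrow> H (0, x) = f x"
    "\<And>t. t \<in> {0..1} \<Longrightarrow> H (t, a) = h (t, a)"
proof -
  have "\<forall>a'\<in>{a}. h (0, a') = f a'" using assms(4) by simp
  from cofibration_imp_homotopy_extension_property[OF assms(1), of Z,
      unfolded homotopy_extension_property_def, rule_format, OF conjI[OF assms(2) conjI[OF assms(3) this]]]
  show ?thesis using that by auto
qed

text \<open>Gluing \<open>L\<close> and \<open>L'\<close> at their common start sends each
  \<open>x\<close> to a path from \<open>L (1, x)\<close> to \<open>L' (1, x)\<close>. The path of
  \<open>a\<close> contracts to a constant one with its ends fixed. Homotopy extension into the path
  space spreads this contraction over \<open>X\<close>, and three sides of the resulting square form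
  the based homotopy.\<close>

lemma based_homotopic_ends:
  assumes cof: "cofibration X {a}"
    and L: "continuous_map (prod_topology (top_of_set {0..1::real}) X) Z L"
    and L': "continuous_map (prod_topology (top_of_set {0..1::real}) X) Z L'"
    and start: "\<And>x. x \<in> topspace X \<Longrightarrow> L (0, x) = L' (0, x)"
    and track: "\<And>t. t \<in> {0..1} \<Longrightarrow> L (t, a) = L' (t, a)"
  shows "based_homotopic X a Z (L (1, a)) (\<lambda>x. L (1, x)) (\<lambda>x. L' (1, x))"
proof -
  have a: "a \<in> topspace X" using cof by (simp add: cofibration_def)
  let ?D = "top_of_set {-1..1::real}" and ?I = "top_of_set {0..1::real}"
  have D: "neighbourhood_base_of (compactin ?D) ?D"
  proof -
    have "locally_compact_space ?D"
      by (intro compact_imp_locally_compact_space) (simp add: compact_space_subtopology)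
    moreover have "Hausdorff_space ?D" by (simp add: Hausdorff_space_subtopology)
    ultimately show ?thesis
      using locally_compact_space_neighbourhood_base by blast
  qed
  \<comment> \<open>\<open>L\<close> run backwards followed by \<open>L'\<close>, with both starts glued at parameter \<open>0\<close>.\<close>
  define J where "J = (\<lambda>p. if fst p \<le> (0::real) then L (- fst p, snd p) else L' (fst p, snd p))"
  have J: "continuous_map (prod_topology ?D X) Z J"
    unfolding J_def
  proof (rule continuous_map_cases_le)
    have f: "continuous_map (prod_topology ?D X) euclideanreal fst"
      using continuous_map_into_fulltopology continuous_map_fst by blast
    show "continuous_map (prod_topology ?D X) euclideanreal fst" by (rule f)
    show "continuous_map (subtopology (prod_topology ?D X) {x \<in> topspace (prod_topology ?D X). fst x \<le> 0}) Z
          (\<lambda>p. L (- fst p, snd p))"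
      by (intro continuous_map_reparam[OF L] continuous_map_from_subtopology continuous_map_minus f continuous_map_snd) auto
    show "continuous_map (subtopology (prod_topology ?D X) {x \<in> topspace (prod_topology ?D X). 0 \<le> fst x}) Z
          (\<lambda>p. L' (fst p, snd p))"
      by (intro continuous_map_reparam[OF L'] continuous_map_from_subtopology f continuous_map_snd) auto
  qed (use start in auto)
  define f where "f = (\<lambda>x. restrict (\<lambda>s. J (s, x)) {-1..1})"
  \<comment> \<open>The loop \<open>J (_, a)\<close> goes back and forth along one path, so at time \<open>t\<close> the part with
    \<open>\<bar>s\<bar> < t\<close> can be cut off; then \<open>a\<close> stays at \<open>L (1, a)\<close> along three sides of the square.\<close>
  define h where "h = (\<lambda>p::real \<times> 'a. restrict (\<lambda>s. L (max \<bar>s\<bar> (fst p), a)) {-1..1})"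
  have f: "continuous_map X (compact_open_topology ?D Z) f"
    by (intro continuous_map_curry continuous_map_eq[OF J]) (auto simp: f_def)
  have h: "continuous_map (prod_topology ?I (subtopology X {a})) (compact_open_topology ?D Z) h"
  proof (rule continuous_map_curry)
    let ?P = "prod_topology ?D (prod_topology ?I (subtopology X {a}))"
    have 1: "continuous_map ?P euclideanreal fst"
      using continuous_map_into_fulltopology continuous_map_fst by blast
    have 2: "continuous_map ?P euclideanreal (\<lambda>w. fst (snd w))"
      using continuous_map_compose[OF continuous_map_snd continuous_map_fst, unfolded o_def]
        continuous_map_into_fulltopology by blast
    have "continuous_map ?P Z (\<lambda>w. L (max \<bar>fst w\<bar> (fst (snd w)), a))"
      by (intro continuous_map_reparam[OF L] continuous_map_real_max continuous_map_real_abs 1 2) (use a in auto)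
    then show "continuous_map ?P Z (\<lambda>(s, p). h p s)"
      by (rule continuous_map_eq) (auto simp: h_def)
  qed
  \<comment> \<open>Both sides run through \<open>L (\<bar>s\<bar>, a)\<close>, for positive
    \<open>s\<close> by \<open>track\<close>. Restricting to \<open>[-1, 1]\<close> turns agreement
    there into equality of functions, as homotopy extension requires.\<close>
  have hf: "h (0, a) = f a"
    unfolding h_def f_def using track by (intro restrict_ext) (auto simp: J_def)
  obtain \<Phi> where \<Phi>: "continuous_map (prod_topology ?I X) (compact_open_topology ?D Z) \<Phi>"
      and \<Phi>0: "\<And>x. x \<in> topspace X \<Longrightarrow> \<Phi> (0, x) = f x"
      and \<Phi>a: "\<And>t. t \<in> {0..1} \<Longrightarrow> \<Phi> (t, a) = h (t, a)"
    using cofibration_singleton_extend[OF cof f h hf] by blast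
  have E: "continuous_map (prod_topology ?D (prod_topology ?I X)) Z (\<lambda>(s, p). \<Phi> p s)"
    using D \<Phi> by (rule continuous_map_uncurry)
  \<comment> \<open>Here \<open>q\<close> and \<open>r\<close> trace a path in the square of times
    \<open>t\<close> and path parameters \<open>s\<close>; each of the three sides is one choice of
    the pair.\<close>
  have E': "continuous_map (prod_topology ?I X) Z (\<lambda>w. \<Phi> (q w, snd w) (r w))"
    if "continuous_map (prod_topology ?I X) euclideanreal q" "continuous_map (prod_topology ?I X) euclideanreal r"
      "q \<in> topspace (prod_topology ?I X) \<rightarrow> {0..1}" "r \<in> topspace (prod_topology ?I X) \<rightarrow> {-1..1}" for q r
  proof -
    have "continuous_map (prod_topology ?I X) (prod_topology ?I X) (\<lambda>w. (q w, snd w))"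
      using that continuous_map_snd by (auto simp: continuous_map_pairwise o_def continuous_map_in_subtopology)
    from continuous_map_reparam[OF E this that(2) that(4)] show ?thesis by simp
  qed
  have t: "continuous_map (prod_topology ?I X) euclideanreal fst"
    using continuous_map_into_fulltopology continuous_map_fst by blast
  let ?R = "homotopic_with (\<lambda>h. h a = L (1, a)) X Z"
  \<comment> \<open>For \<open>s = -1\<close> or \<open>s = 1\<close> the maximum in
    \<open>h\<close> is \<open>1\<close> at every time, so \<open>a\<close> stays at
    \<open>L (1, a)\<close>.\<close>
  have side: "?R (\<lambda>x. \<Phi> (0, x) s) (\<lambda>x. \<Phi> (1, x) s)" if "s \<in> {-1, 1}" for s
    unfolding homotopic_with_def
  proof (intro exI conjI ballI allI)
    show "continuous_map (prod_topology ?I X) Z (\<lambda>w. \<Phi> (fst w, snd w) s)"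
      by (rule E') (use t that in auto)
    show "\<Phi> (fst (t, a), snd (t, a)) s = L (1, a)" if "t \<in> {0..1}" for t
      using \<Phi>a[OF that] that \<open>s \<in> {-1, 1}\<close> by (auto simp: h_def max_def)
  qed auto
  have top: "?R (\<lambda>x. \<Phi> (1, x) (-1)) (\<lambda>x. \<Phi> (1, x) 1)"
    unfolding homotopic_with_def
  proof (intro exI conjI ballI allI)
    \<comment> \<open>The factor \<open>2 * fst w - 1\<close> rescales \<open>[0, 1]\<close> to
      \<open>[-1, 1]\<close>. At time \<open>1\<close> the whole path of \<open>a\<close> is
      constant.\<close>
    show "continuous_map (prod_topology ?I X) Z (\<lambda>w. \<Phi> (1, snd w) (2 * fst w - 1))"
      by (rule E') (use t in \<open>auto intro!: continuous_map_diff continuous_map_real_mult_left\<close>)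
    show "\<Phi> (1, snd (t, a)) (2 * fst (t, a) - 1) = L (1, a)" if "t \<in> {0..1}" for t
      using \<Phi>a[of 1] that by (auto simp: h_def max_def)
  qed auto
  \<comment> \<open>Up the side \<open>s = -1\<close>, across the top and down the side
    \<open>s = 1\<close>. The two lower corners are the ends of \<open>L\<close> and
    \<open>L'\<close>.\<close>
  have "?R (\<lambda>x. \<Phi> (0, x) (-1)) (\<lambda>x. \<Phi> (0, x) 1)"
    using homotopic_with_trans[OF homotopic_with_trans[OF side top] homotopic_with_symD[OF side]] by auto
  then show ?thesis
    unfolding based_homotopic_def
    by (rule homotopic_with_eq) (use a in \<open>auto simp: \<Phi>0 f_def J_def\<close>)
qed


section \<open>Calculus of based homotopies\<close>

lemma based_homotopic_trans:
  "based_homotopic X a Y b f g \<Longrightarrow> based_homotopic X a Y b g h \<Longrightarrow> based_homotopic X a Y b f h"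
  unfolding based_homotopic_def by (rule homotopic_with_trans)

lemma based_homotopic_sym:
  "based_homotopic X a Y b f g \<Longrightarrow> based_homotopic X a Y b g f"
  unfolding based_homotopic_def by (rule homotopic_with_symD)

lemma based_homotopic_compose_left:
  "based_homotopic X a Y b f g \<Longrightarrow> based_map Y b Z c h \<Longrightarrow> based_homotopic X a Z c (h \<circ> f) (h \<circ> g)"
  unfolding based_homotopic_def based_map_def
  by (elim conjE) (rule homotopic_with_compose_continuous_map_left, assumption+, simp)

lemma based_homotopic_compose_right:
  "based_homotopic Y b Z c f g \<Longrightarrow> based_map X a Y b h \<Longrightarrow> based_homotopic X a Z c (f \<circ> h) (g \<circ> h)"
  unfolding based_homotopic_def based_map_def
  by (elim conjE) (rule homotopic_with_compose_continuous_map_right, assumption+, simp)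

lemma based_map_compose:
  "based_map X a Y b f \<Longrightarrow> based_map Y b Z c g \<Longrightarrow> based_map X a Z c (g \<circ> f)"
  unfolding based_map_def by (auto intro: continuous_map_compose)

section \<open>From free to based homotopy equivalences\<close>

text \<open>Homotopy extension drags the value at \<open>a\<close> along a path from
  \<open>f a\<close> to \<open>b\<close>.\<close>

lemma homotopic_to_map_with_value:
  assumes cof: "cofibration X {a}" and f: "continuous_map X Z f" and p: "path_component_of Z (f a) b"
  obtains f' where "based_map X a Z b f'" "homotopic_with (\<lambda>_. True) X Z f f'"
proof -
  obtain \<gamma> where \<gamma>: "continuous_map (top_of_set {0..1::real}) Z \<gamma>" "\<gamma> 0 = f a" "\<gamma> 1 = b"
    using p by (auto simp: path_component_of_def pathin_def)
  have "continuous_map (prod_topology (top_of_set {0..1::real}) (subtopology X {a})) Z (\<gamma> \<circ> fst)"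
    using continuous_map_fst \<gamma>(1) by (rule continuous_map_compose)
  then obtain H where H: "continuous_map (prod_topology (top_of_set {0..1::real}) X) Z H"
      "\<And>x. x \<in> topspace X \<Longrightarrow> H (0, x) = f x"
      "\<And>t. t \<in> {0..1} \<Longrightarrow> H (t, a) = \<gamma> t"
    using cofibration_singleton_extend[OF cof f] \<gamma>(2) by (metis comp_apply fst_conv)
  have "homotopic_with (\<lambda>_. True) X Z (\<lambda>x. H (0, x)) (\<lambda>x. H (1, x))"
    using H(1) by (auto simp: homotopic_with_def)
  then have hom: "homotopic_with (\<lambda>_. True) X Z f (\<lambda>x. H (1, x))"
    by (rule homotopic_with_eq) (use H(2) in auto)
  then have "based_map X a Z b (\<lambda>x. H (1, x))"
    using homotopic_with_imp_continuous_maps[OF hom] H(3)[of 1] \<gamma>(3) by (simp add: based_map_def)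
  then show ?thesis using that hom by blast
qed

text \<open>A free homotopy \<open>H\<close> from \<open>f\<close> to the identity moves
  \<open>a\<close> around a loop. Extending that loop to a homotopy \<open>K\<close> that starts at
  the identity gives \<open>k\<close> as its end.\<close>

lemma homotopic_id_imp_based_left_inverse:
  assumes cof: "cofibration X {a}" and f: "based_map X a X a f" and "homotopic_with (\<lambda>_. True) X X f id"
  obtains k where "based_map X a X a k" "homotopic_with (\<lambda>_. True) X X k id"
    "based_homotopic X a X a (k \<circ> f) id"
proof -
  let ?I = "top_of_set {0..1::real}"
  have a: "a \<in> topspace X" using cof by (simp add: cofibration_def)
  have fa: "f a = a" and fc: "continuous_map X X f" using f by (auto simp: based_map_def)
  obtain H where H: "continuous_map (prod_topology ?I X) X H" "\<And>x. H (0, x) = f x" "\<And>x. H (1, x) = x"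
    using assms(3) by (auto simp: homotopic_with_def)
  have "continuous_map (prod_topology ?I (subtopology X {a})) (prod_topology ?I X) id"
    by (metis continuous_map_from_subtopology continuous_map_id prod_topology_subtopology(2))
  from continuous_map_compose[OF this H(1)]
  have "continuous_map (prod_topology ?I (subtopology X {a})) X H" by simp
  then obtain K where K: "continuous_map (prod_topology ?I X) X K"
      "\<And>x. x \<in> topspace X \<Longrightarrow> K (0, x) = x"
      "\<And>t. t \<in> {0..1} \<Longrightarrow> K (t, a) = H (t, a)"
    using cofibration_singleton_extend[OF cof continuous_map_id] fa H(2) by (metis id_apply)
  have Ka: "K (1, a) = a" using K(3)[of 1] H(3) by simp
  have "homotopic_with (\<lambda>_. True) X X (\<lambda>x. K (0, x)) (\<lambda>x. K (1, x))"
    using K(1) by (auto simp: homotopic_with_def)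
  then have hom: "homotopic_with (\<lambda>_. True) X X id (\<lambda>x. K (1, x))"
    by (rule homotopic_with_eq) (use K(2) in auto)
  then have k: "based_map X a X a (\<lambda>x. K (1, x))"
    using homotopic_with_imp_continuous_maps[OF hom] Ka by (simp add: based_map_def)
  \<comment> \<open>This homotopy starts at \<open>f\<close> and moves \<open>a\<close> around the
    same loop as \<open>H\<close>. Hence its end \<open>k \<circ> f\<close> and the end
    \<open>id\<close> of \<open>H\<close> are homotopic relative to \<open>a\<close>.\<close>
  have "continuous_map (prod_topology ?I X) X (\<lambda>w. K (fst w, f (snd w)))"
  proof (rule continuous_map_reparam[OF K(1)])
    show "continuous_map (prod_topology ?I X) X (\<lambda>w. f (snd w))"
      using continuous_map_compose[OF continuous_map_snd fc] by (simp add: o_def)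
    show "continuous_map (prod_topology ?I X) euclideanreal fst"
      using continuous_map_into_fulltopology continuous_map_fst by blast
  qed auto
  moreover have "K (0, f x) = f x" if "x \<in> topspace X" for x
    using K(2) continuous_map_funspace[OF fc] that by blast
  ultimately have "based_homotopic X a X a (\<lambda>x. K (1, f x)) (\<lambda>x. x)"
    using based_homotopic_ends[OF cof _ H(1), of "\<lambda>w. K (fst w, f (snd w))"] K(3) H(2,3) fa Ka by simp
  then show ?thesis using that[OF k] homotopic_with_symD[OF hom] by (simp add: o_def id_def)
qed

lemma homotopic_id_imp_based_inverse:
  assumes cof: "cofibration X {a}" and f: "based_map X a X a f" "homotopic_with (\<lambda>_. True) X X f id"
  obtains k where "based_map X a X a k"
    "based_homotopic X a X a (k \<circ> f) id" "based_homotopic X a X a (f \<circ> k) id"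
proof -
  obtain k where k: "based_map X a X a k" "homotopic_with (\<lambda>_. True) X X k id"
    "based_homotopic X a X a (k \<circ> f) id"
    using homotopic_id_imp_based_left_inverse[OF assms] .
  \<comment> \<open>A left inverse of the left inverse \<open>k\<close> makes \<open>k\<close> two-sided.\<close>
  obtain l where l: "based_map X a X a l" "based_homotopic X a X a (l \<circ> k) id"
    using homotopic_id_imp_based_left_inverse[OF cof k(1,2)] .
  \<comment> \<open>Cancelling \<open>k \<circ> f\<close> or \<open>l \<circ> k\<close> in the
    triple composite shows that \<open>l\<close> and \<open>f\<close> are based homotopic.\<close>
  have 1: "based_homotopic X a X a (l \<circ> k \<circ> f) l"
    using based_homotopic_compose_left[OF k(3) l(1)] by (simp add: comp_assoc)
  have 2: "based_homotopic X a X a (l \<circ> k \<circ> f) f"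
    using based_homotopic_compose_right[OF l(2) f(1)] by simp
  have "based_homotopic X a X a (f \<circ> k) (l \<circ> k)"
    using based_homotopic_compose_right[OF based_homotopic_trans[OF based_homotopic_sym[OF 2] 1] k(1)] .
  from that[OF k(1,3) based_homotopic_trans[OF this l(2)]] show ?thesis .
qed

lemma homotopy_equivalent_imp_based_homotopy_equivalent:
  assumes eq: "X homotopy_equivalent_space Y"
    and conn: "path_connected_space X" "path_connected_space Y"
    and nondeg: "nondegenerate_basepoint X a" "nondegenerate_basepoint Y b"
  shows "based_homotopy_equivalent X a Y b"
proof -
  have a: "a \<in> topspace X" "cofibration X {a}" and b: "b \<in> topspace Y" "cofibration Y {b}"
    using nondeg by (auto simp: nondegenerate_basepoint_def)
  obtain f0 g0 where f0: "continuous_map X Y f0" and g0: "continuous_map Y X g0"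
    and gf0: "homotopic_with (\<lambda>x. True) X X (g0 \<circ> f0) id" and fg0: "homotopic_with (\<lambda>x. True) Y Y (f0 \<circ> g0) id"
    using eq by (auto simp: homotopy_equivalent_space_def)
  have "path_component_of Y (f0 a) b"
    using conn(2) a b continuous_map_funspace[OF f0] by (auto simp: path_connected_space_iff_path_component)
  then obtain f where f: "based_map X a Y b f" "homotopic_with (\<lambda>_. True) X Y f0 f"
    using homotopic_to_map_with_value[OF a(2) f0] by blast
  have "path_component_of X (g0 b) a"
    using conn(1) a b continuous_map_funspace[OF g0] by (auto simp: path_connected_space_iff_path_component)
  then obtain g where g: "based_map Y b X a g" "homotopic_with (\<lambda>_. True) Y X g0 g"
    using homotopic_to_map_with_value[OF b(2) g0] by blast
  have fc: "continuous_map X Y f" and gc: "continuous_map Y X g"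
    using f g by (auto simp: based_map_def)
  have "homotopic_with (\<lambda>_. True) X X (g0 \<circ> f0) (g0 \<circ> f)"
    using f(2) g0 by (rule homotopic_with_compose_continuous_map_left) simp
  moreover have "homotopic_with (\<lambda>_. True) X X (g0 \<circ> f) (g \<circ> f)"
    using g(2) fc by (rule homotopic_with_compose_continuous_map_right) simp
  ultimately have gf: "homotopic_with (\<lambda>_. True) X X (g \<circ> f) id"
    by (intro homotopic_with_trans[OF homotopic_with_symD gf0]) (rule homotopic_with_trans)
  have "homotopic_with (\<lambda>_. True) Y Y (f0 \<circ> g0) (f0 \<circ> g)"
    using g(2) f0 by (rule homotopic_with_compose_continuous_map_left) simp
  moreover have "homotopic_with (\<lambda>_. True) Y Y (f0 \<circ> g) (f \<circ> g)"
    using f(2) gc by (rule homotopic_with_compose_continuous_map_right) simp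
  ultimately have fg: "homotopic_with (\<lambda>_. True) Y Y (f \<circ> g) id"
    by (intro homotopic_with_trans[OF homotopic_with_symD fg0]) (rule homotopic_with_trans)
  \<comment> \<open>Both composites of the based maps \<open>f\<close> and \<open>g\<close> are
    freely homotopic to the identity, hence invertible up to based homotopy. This gives
    \<open>f\<close> the left inverse \<open>k \<circ> g\<close> and the right inverse
    \<open>g \<circ> l\<close>.\<close>
  obtain k where k: "based_map X a X a k" "based_homotopic X a X a (k \<circ> (g \<circ> f)) id"
    using homotopic_id_imp_based_inverse[OF a(2) based_map_compose[OF f(1) g(1)] gf] .
  obtain l where l: "based_map Y b Y b l" "based_homotopic Y b Y b ((f \<circ> g) \<circ> l) id"
    using homotopic_id_imp_based_inverse[OF b(2) based_map_compose[OF g(1) f(1)] fg] .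
  define p where "p = k \<circ> g"
  define q where "q = g \<circ> l"
  have p: "based_map Y b X a p" and q: "based_map Y b X a q"
    using based_map_compose[OF g(1) k(1)] based_map_compose[OF l(1) g(1)] by (simp_all add: p_def q_def)
  have pf: "based_homotopic X a X a (p \<circ> f) id" and fq: "based_homotopic Y b Y b (f \<circ> q) id"
    using k(2) l(2) by (simp_all add: p_def q_def comp_assoc)
  \<comment> \<open>A left and a right inverse of \<open>f\<close> agree up to based homotopy, so
    \<open>p\<close> is two-sided.\<close>
  have 1: "based_homotopic Y b X a (p \<circ> f \<circ> q) p"
    using based_homotopic_compose_left[OF fq p] by (simp add: comp_assoc)
  have 2: "based_homotopic Y b X a (p \<circ> f \<circ> q) q"
    using based_homotopic_compose_right[OF pf q] by simp
  have "based_homotopic Y b Y b (f \<circ> p) (f \<circ> q)"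
    using based_homotopic_compose_left[OF based_homotopic_trans[OF based_homotopic_sym[OF 1] 2] f(1)] .
  then have "based_homotopic Y b Y b (f \<circ> p) id" using fq by (rule based_homotopic_trans)
  then show ?thesis unfolding based_homotopy_equivalent_def using f(1) p pf by (intro exI conjI)
qed

section \<open>Path components and actions\<close>

text \<open>The track of \<open>x\<close> is the path. Applied to the inverse laws it joins
  \<open>m (\<iota> g, g)\<close> and \<open>m (g, \<iota> g)\<close> to \<open>e\<close>.\<close>

lemma homotopic_imp_path_component_of:
  assumes "homotopic_with P X Y f g" "x \<in> topspace X"
  shows "path_component_of Y (f x) (g x)"
proof -
  obtain h where h: "continuous_map (prod_topology (top_of_set {0..1::real}) X) Y h"
      "\<And>x. h (0, x) = f x" "\<And>x. h (1, x) = g x"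
    using assms(1) by (auto simp: homotopic_with_def)
  have "continuous_map (top_of_set {0..1::real}) (prod_topology (top_of_set {0..1}) X) (\<lambda>t. (t, x))"
    using assms(2) by (simp add: continuous_map_pairwise o_def)
  from continuous_map_compose[OF this h(1)]
  have "pathin Y (\<lambda>t. h (t, x))" by (simp add: pathin_def o_def)
  then show ?thesis unfolding path_component_of_def using h by blast
qed

lemma topspace_path_component_space:
  "topspace (path_component_space X x) = path_component_of_set X x"
  using path_component_of_subset_topspace[of X x] by (auto simp: path_component_space_def)

lemma path_connected_path_component_space: "path_connected_space (path_component_space X x)"
  using path_connectedin_path_component_of[of X x] by (simp add: path_component_space_def path_connectedin_def)

text \<open>The target component is named by any \<open>y\<close> joined to \<open>f x\<close>,
  because an inverse up to homotopy returns \<open>x\<close> only to its path component.\<close>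

lemma continuous_map_path_component_space:
  assumes f: "continuous_map X Y f" and p: "path_component_of Y (f x) y"
  shows "continuous_map (path_component_space X x) (path_component_space Y y) f"
proof -
  have "path_component_of Y y (f z)" if "path_component_of X x z" for z
    using path_component_of_continuous_image[OF f that] p path_component_of_trans path_component_of_sym by metis
  then show ?thesis
    unfolding path_component_space_def
    by (auto simp: continuous_map_in_subtopology intro: continuous_map_from_subtopology[OF f])
qed

text \<open>Each track ends at its own starting label \<open>z\<close>, so for \<open>z\<close> in
  the component the whole track lies in the component.\<close>

lemma homotopic_id_path_component_space:
  assumes f: "homotopic_with (\<lambda>_. True) X X f id"
  shows "homotopic_with (\<lambda>_. True) (path_component_space X x) (path_component_space X x) f id"
proof -
  let ?I = "top_of_set {0..1::real}" and ?P = "path_component_space X x"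
  obtain h where h: "continuous_map (prod_topology ?I X) X h"
      "\<And>x. h (0, x) = f x" "\<And>x. h (1, x) = x"
    using f by (auto simp: homotopic_with_def)
  have conn: "path_connected_space ?I"
    using path_connectedin_def[of euclideanreal "{0..1}"] by (simp add: is_interval_path_connected)
  have "path_component_of X x (h (t, z))" if t: "t \<in> {0..1}" and z: "path_component_of X x z" for t z
  proof -
    have zX: "z \<in> topspace X" using path_component_in_topspace[OF z] by simp
    have "t \<in> path_component_of_set ?I 1"
      using t path_connected_space_imp_path_component_of[OF conn, of 1 t] by simp
    moreover have "z \<in> path_component_of_set X z" using zX by (simp add: path_component_of_refl)
    \<comment> \<open>Time \<open>1\<close> is the reference because
      \<open>h (1, z) = z\<close>.\<close>
    ultimately have "(t, z) \<in> path_component_of_set (prod_topology ?I X) (1, z)"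
      unfolding path_component_of_pair by (rule SigmaI)
    then have "path_component_of (prod_topology ?I X) (1, z) (t, z)" by (rule CollectD)
    from path_component_of_continuous_image[OF h(1) this] show ?thesis
      using z h(3) path_component_of_trans by metis
  qed
  moreover have "continuous_map (prod_topology ?I ?P) X h"
    using continuous_map_from_subtopology[OF h(1)]
    by (simp add: path_component_space_def prod_topology_subtopology(2))
  ultimately have "continuous_map (prod_topology ?I ?P) ?P h"
    by (subst (2) path_component_space_def) (auto simp: continuous_map_in_subtopology topspace_path_component_space)
  then show ?thesis
    unfolding homotopic_with_def using h by (intro exI[of _ h]) simp
qed

lemma homotopy_equivalent_path_component_space:
  assumes "continuous_map X X f" "continuous_map X X g"
    and gf: "homotopic_with (\<lambda>_. True) X X (g \<circ> f) id" and fg: "homotopic_with (\<lambda>_. True) X X (f \<circ> g) id"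
    and x: "x \<in> topspace X"
  shows "path_component_space X x homotopy_equivalent_space path_component_space X (f x)"
  unfolding homotopy_equivalent_space_def
proof (intro exI conjI)
  show "continuous_map (path_component_space X x) (path_component_space X (f x)) f"
    using assms(1) x continuous_map_funspace[OF assms(1)]
    by (intro continuous_map_path_component_space) (auto simp: path_component_of_refl)
  show "continuous_map (path_component_space X (f x)) (path_component_space X x) g"
    using homotopic_imp_path_component_of[OF gf x] assms(2)
    by (intro continuous_map_path_component_space) auto
qed (intro homotopic_id_path_component_space gf fg)+

section \<open>Translations by elements of the group-like space\<close>

text \<open>Acting with the points of a path from \<open>g\<close> to \<open>h\<close> is the
  homotopy. It is free, since intermediate points may move \<open>y0\<close>.\<close>

lemma action_homotopic:
  assumes A: "continuous_map (prod_topology G Y) Y A" and p: "path_component_of G g h"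
  shows "homotopic_with (\<lambda>_. True) Y Y (\<lambda>y. A (g, y)) (\<lambda>y. A (h, y))"
proof -
  let ?I = "top_of_set {0..1::real}"
  obtain \<gamma> where \<gamma>: "continuous_map ?I G \<gamma>" "\<gamma> 0 = g" "\<gamma> 1 = h"
    using p by (auto simp: path_component_of_def pathin_def)
  have "continuous_map (prod_topology ?I Y) (prod_topology G Y) (\<lambda>w. (\<gamma> (fst w), snd w))"
    using continuous_map_compose[OF continuous_map_fst \<gamma>(1), of Y] continuous_map_snd
    by (auto simp: continuous_map_pairwise o_def)
  from continuous_map_compose[OF this A]
  have "continuous_map (prod_topology ?I Y) Y (\<lambda>w. A (\<gamma> (fst w), snd w))" by (simp add: o_def)
  then show ?thesis
    unfolding homotopic_with_def using \<gamma> by (intro exI[of _ "\<lambda>w. A (\<gamma> (fst w), snd w)"]) auto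
qed

text \<open>The chain is \<open>g(hy) ~ (gh)y ~ ey ~ y\<close>: associativity on the slice over
  \<open>(g, h)\<close>, the path from \<open>m (g, h)\<close> to \<open>e\<close>, and the unit
  law.\<close>

lemma action_compose_homotopic_id:
  assumes A: "homotopy_associative_action G e m Y y0 A"
    and gh: "g \<in> topspace G" "h \<in> topspace G" and p: "path_component_of G (m (g, h)) e"
  shows "homotopic_with (\<lambda>_. True) Y Y ((\<lambda>y. A (g, y)) \<circ> (\<lambda>y. A (h, y))) id"
proof -
  have Ac: "continuous_map (prod_topology G Y) Y A"
    and unit: "homotopic_with (\<lambda>_. True) Y Y (\<lambda>y. A (e, y)) id"
    and assoc: "homotopic_with (\<lambda>_. True) (prod_topology G (prod_topology G Y)) Y
       (\<lambda>(a, b, y). A (a, A (b, y))) (\<lambda>(a, b, y). A (m (a, b), y))"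
    using A unfolding homotopy_associative_action_def based_map_def based_homotopic_def
    by (auto elim: homotopic_with_mono)
  have "continuous_map Y (prod_topology G (prod_topology G Y)) (\<lambda>y. (g, h, y))"
    using gh by (simp add: continuous_map_pairwise o_def)
  from homotopic_with_compose_continuous_map_right[OF assoc this, of "\<lambda>_. True"]
  have "homotopic_with (\<lambda>_. True) Y Y ((\<lambda>y. A (g, y)) \<circ> (\<lambda>y. A (h, y))) (\<lambda>y. A (m (g, h), y))"
    by (simp add: o_def)
  then show ?thesis
    by (rule homotopic_with_trans[OF homotopic_with_trans[OF _ action_homotopic[OF Ac p]] unit])
qed

theorem theorem2p2:
  fixes G :: "'g topology" and e :: 'g and m :: "'g \<times> 'g \<Rightarrow> 'g" and \<iota> :: "'g \<Rightarrow> 'g"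
    and Y :: "'y topology" and y0 :: 'y and A :: "'g \<times> 'y \<Rightarrow> 'y"
  assumes "group_like_space G e m \<iota>"
    and "homotopy_associative_action G e m Y y0 A"
  shows "\<forall>x \<in> topspace Y. \<forall>g \<in> topspace G.
           path_component_space Y x homotopy_equivalent_space path_component_space Y (A (g, x)) \<and>
           (\<forall>a b. nondegenerate_basepoint (path_component_space Y x) a \<and>
                  nondegenerate_basepoint (path_component_space Y (A (g, x))) b \<longrightarrow>
              based_homotopy_equivalent (path_component_space Y x) a
                (path_component_space Y (A (g, x))) b)"
proof (intro ballI)
  fix x g assume x: "x \<in> topspace Y" and g: "g \<in> topspace G"
  have \<iota>: "continuous_map G G \<iota>"
    and left: "homotopic_with (\<lambda>h. h e = e) G G (\<lambda>a. m (\<iota> a, a)) (\<lambda>_. e)"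
    and right: "homotopic_with (\<lambda>h. h e = e) G G (\<lambda>a. m (a, \<iota> a)) (\<lambda>_. e)"
    using assms(1) unfolding group_like_space_def based_map_def based_homotopic_def by auto
  have \<iota>g: "\<iota> g \<in> topspace G" using continuous_map_funspace[OF \<iota>] g by blast
  have Ac: "continuous_map (prod_topology G Y) Y A"
    using assms(2) by (simp add: homotopy_associative_action_def based_map_def)
  \<comment> \<open>Continuity is read off from the homotopy belonging to the trivial path from
    \<open>h\<close> to itself.\<close>
  have act: "continuous_map Y Y (\<lambda>y. A (h, y))" if "h \<in> topspace G" for h
    using homotopic_with_imp_continuous_maps[OF action_homotopic[OF Ac, of h h]] that
    by (simp add: path_component_of_refl)
  have "path_component_space Y x homotopy_equivalent_space path_component_space Y (A (g, x))"
    \<comment> \<open>The path from \<open>left\<close> handles the composite with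
      \<open>\<iota> g\<close> applied last, the one from \<open>right\<close> the composite with
      \<open>g\<close> applied last.\<close>
    by (rule homotopy_equivalent_path_component_space[of Y "\<lambda>y. A (g, y)" "\<lambda>y. A (\<iota> g, y)"])
       (intro act action_compose_homotopic_id[OF assms(2)] g \<iota>g x
          homotopic_imp_path_component_of[OF left g] homotopic_imp_path_component_of[OF right g])+
  then show "path_component_space Y x homotopy_equivalent_space path_component_space Y (A (g, x)) \<and>
           (\<forall>a b. nondegenerate_basepoint (path_component_space Y x) a \<and>
                  nondegenerate_basepoint (path_component_space Y (A (g, x))) b \<longrightarrow>
              based_homotopy_equivalent (path_component_space Y x) a
                (path_component_space Y (A (g, x))) b)"
    by (blast intro: homotopy_equivalent_imp_based_homotopy_equivalent path_connected_path_component_space)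
qed

end
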